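(* Let $q\in(0,1)$. Let $\{A_n\}_{n\ge 1}$ be a sequence of real numbers such that $A_1=1$, and put $B_n=\dfrac{A_n(1-q^n)}{1-q}$ for all $n\ge 1$. Suppose that either $$0\ge B_2-B_1\ge B_3\ge B_2+B_4\ge B_2+B_3+B_5\ge\cdots\ge B_2+B_3+B_4+\cdots+B_{n-1}+B_{n+1}\ge\cdots\ge -1$$ or $$0\le B_2-B_1\le B_3\le B_2+B_4\le B_2+B_3+B_5\le\cdots\le B_2+B_3+B_4+\cdots+B_{n-1}+B_{n+1}\le\cdots\le 1$$ holds (the chains being infinite, with general term $\sum_{k=2}^{n-1}B_k+B_{n+1}$, $n\ge 2$, after the term $B_2-B_1$). Then $f(z)=z+\sum_{n=2}^\infty A_nz^n$ belongs to $\mathcal{K}_q$ with the function $g(z)=z/(1-z+z^2)$.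
   Context: $\mathbb{D}=\{z\in\mathbb{C}:|z|<1\}$. $\mathcal{A}$ is the class of functions $f$ analytic in $\mathbb{D}$ with $f(0)=0=f'(0)-1$. $\mathcal{S}^*\subset\mathcal{A}$ is the class of univalent functions $g\in\mathcal{A}$ that are starlike with respect to the origin ($tw\in g(\mathbb{D})$ whenever $t\in[0,1]$, $w\in g(\mathbb{D})$). For $q\in(0,1)$ and $f\in\mathcal{A}$, the $q$-difference operator is $(D_qf)(z)=\dfrac{f(z)-f(qz)}{z(1-q)}$ for $z\in\mathbb{D}\setminus\{0\}$, and $(D_qf)(0)=f'(0)$. A function $f\in\mathcal{A}$ belongs to $\mathcal{K}_q$ ($q$-close-to-convex functions) if there exists $g\in\mathcal{S}^*$ such that $$\left|\frac{z}{g(z)}(D_qf)(z)-\frac{1}{1-q}\right|\le\frac{1}{1-q},\quad z\in\mathbb{D}$$ (where $z/g(z)$ is given its limit value $1$ at $z=0$); one then says that $f\in\mathcal{K}_q$ with the function $g$. *)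

theory Defs
  imports "HOL-Complex_Analysis.Complex_Analysis"
begin

abbreviation unit_disk :: "complex set"
  where "unit_disk \<equiv> ball 0 1"

(* Functions on the disk are total functions on complex; their values outside the
   disk are irrelevant for every notion below. *)
definition normalized_analytic :: "(complex \<Rightarrow> complex) set"
  where "normalized_analytic = {f. f analytic_on unit_disk \<and> f 0 = 0 \<and> deriv f 0 = 1}"

(* The library's starlike allows an arbitrary centre; here the centre is the origin. *)
definition starlike_univalent :: "(complex \<Rightarrow> complex) set"
  where "starlike_univalent =
    {g \<in> normalized_analytic. inj_on g unit_disk \<and>
       (\<forall>t\<in>{0..1::real}. \<forall>w\<in>g ` unit_disk. of_real t * w \<in> g ` unit_disk)}"

definition q_difference :: "real \<Rightarrow> (complex \<Rightarrow> complex) \<Rightarrow> complex \<Rightarrow> complex"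
  where "q_difference q f z =
    (if z = 0 then deriv f 0
     else (f z - f (of_real q * z)) / (z * of_real (1 - q)))"

(* The quotient z / g z takes its limit value 1 at the origin. *)
definition q_close_to_convex_with ::
    "real \<Rightarrow> (complex \<Rightarrow> complex) \<Rightarrow> (complex \<Rightarrow> complex) \<Rightarrow> bool"
  where "q_close_to_convex_with q f g \<longleftrightarrow>
    f \<in> normalized_analytic \<and> g \<in> starlike_univalent \<and>
    (\<forall>z\<in>unit_disk.
       cmod ((if z = 0 then 1 else z / g z) * q_difference q f z - of_real (1 / (1 - q)))
         \<le> 1 / (1 - q))"

definition q_close_to_convex :: "real \<Rightarrow> (complex \<Rightarrow> complex) set"
  where "q_close_to_convex q = {f. \<exists>g. q_close_to_convex_with q f g}"

end

theory Submission
  imports Defs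
begin

text \<open>
  Write \<open>b\<^sub>n = B\<^sub>n\<^sub>+\<^sub>1\<close>. Since \<open>D\<^sub>q\<close> multiplies the coefficient of \<open>z ^ n\<close> by \<open>(1 - q ^ n) / (1 - q)\<close>
  and lowers the degree by one, \<open>D\<^sub>q f\<close> has the Taylor coefficients \<open>b\<^sub>n\<close>, and
  \<open>(z / g z) * D\<^sub>q f z = (1 - z + z\<^sup>2) * D\<^sub>q f z\<close> has the Taylor coefficients
  \<open>c\<^sub>n = b\<^sub>n - b\<^sub>n\<^sub>-\<^sub>1 + b\<^sub>n\<^sub>-\<^sub>2\<close>, with \<open>c\<^sub>0 = 1\<close>. The terms of the chain are exactly the partial sums
  \<open>c\<^sub>1 + \<dots> + c\<^sub>n\<close>, so a monotone chain means that the \<open>c\<^sub>n\<close> with \<open>n \<ge> 1\<close> have a common sign, and the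
  bound at its end means that \<open>\<bar>c\<^sub>1\<bar> + \<bar>c\<^sub>2\<bar> + \<dots> \<le> 1\<close>. Hence the product differs from \<open>1\<close> by at
  most \<open>1\<close> in the disk, and as \<open>1 / (1 - q) - 1 = q / (1 - q)\<close>, it differs from \<open>1 / (1 - q)\<close> by at
  most \<open>q / (1 - q) + 1 = 1 / (1 - q)\<close>.

  Two things remain. The series of \<open>f\<close> has to converge in the disk: the coefficients of
  \<open>1 / (1 - z + z\<^sup>2) = (1 + z) / (1 + z ^ 3)\<close> are bounded, so \<open>b\<close> grows at most linearly
  (lemma \<open>coeff_growth\<close>). And \<open>g\<close> has to be starlike: \<open>1 / g z = z + 1 / z - 1\<close> is a translate of the
  Joukowski map, whose image of the punctured disk omits exactly the segment \<open>[-2, 2]\<close>; after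
  translation the omitted segment contains \<open>0\<close>, hence its complement is invariant under dilations
  \<open>v \<mapsto> v / t\<close> with \<open>0 < t \<le> 1\<close> (lemma \<open>starlike_translated_Joukowski\<close>).
\<close>

section \<open>The Joukowski map and starlikeness\<close>

text \<open>This is \<open>z + 1 / z = w + 1 / w\<close> in a form that makes sense at \<open>0\<close>. The constant \<open>c\<close>, which
  cancels, lets it apply both to roots of \<open>1 - c z + z\<^sup>2\<close> and to the injectivity of
  \<open>z / (1 - c z + z\<^sup>2)\<close>.\<close>

lemma quadratic_cross_eqD:
  fixes w z c :: complex
  assumes "z * (1 - c * w + w ^ 2) = w * (1 - c * z + z ^ 2)"
  shows "z = w \<or> z * w = 1"
proof -
  have "(z - w) * (1 - z * w) = 0"
    using assms by (simp add: algebra_simps power2_eq_square)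
  then show ?thesis by auto
qed

text \<open>The points \<open>s\<close> of \<open>[-2, 2]\<close> are the values \<open>w + 1 / w\<close> on the unit circle,
  and each such value is taken only at \<open>w\<close> and \<open>1 / w\<close>.\<close>

lemma Joukowski_omits_segment:
  fixes z :: complex and s :: real
  assumes z: "cmod z < 1" and s: "\<bar>s\<bar> \<le> 2"
  shows "1 - of_real s * z + z ^ 2 \<noteq> 0"
proof
  assume eq: "1 - of_real s * z + z ^ 2 = 0"
  define w where "w = Complex (s / 2) (sqrt (1 - (s / 2) ^ 2))"
  have "\<bar>s / 2\<bar> \<le> 1" using s by simp
  then have "(s / 2) ^ 2 \<le> 1" by (simp only: abs_square_le_1)
  then have norm_w: "cmod w = 1" and
    w: "1 - of_real s * w + w ^ 2 = 0"
    by (simp_all add: w_def cmod_def complex_eq_iff power2_eq_square[of "Complex _ _"])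
      (simp_all add: power2_eq_square)
  from eq w have "z = w \<or> z * w = 1"
    by (intro quadratic_cross_eqD[where c = "of_real s"]) simp
  then show False
    using z norm_w by (metis less_irrefl mult.right_neutral norm_mult norm_one)
qed

text \<open>The two roots of \<open>z\<^sup>2 - s z + 1\<close> have product \<open>1\<close>, so one of them lies in the disk unless both
  lie on the circle; in that case they are conjugate, and \<open>s\<close> is twice their real part.\<close>

lemma Joukowski_image:
  fixes s :: complex
  assumes s: "\<And>r::real. s = of_real r \<Longrightarrow> \<bar>r\<bar> > 2"
  obtains z where "cmod z < 1" "1 - s * z + z ^ 2 = 0"
proof -
  define x where "x = (s + csqrt (s ^ 2 - 4)) / 2"
  define y where "y = (s - csqrt (s ^ 2 - 4)) / 2"
  have xy: "x * y = 1"
  proof -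
    have "x * y = (s ^ 2 - (csqrt (s ^ 2 - 4)) ^ 2) / 4"
      by (simp add: x_def y_def field_simps power2_eq_square)
    then show ?thesis by simp
  qed
  have sum: "x + y = s"
    by (simp add: x_def y_def field_simps)
  have roots: "1 - s * x + x ^ 2 = 0" "1 - s * y + y ^ 2 = 0"
    using xy unfolding sum[symmetric] by (simp_all add: algebra_simps power2_eq_square)
  have "cmod x \<noteq> 1"
  proof
    assume x: "cmod x = 1"
    then have "x * cnj x = 1" by (simp add: complex_norm_square[symmetric])
    with xy have "y = cnj x" using x
      by (metis mult_cancel_left norm_zero zero_neq_one)
    with sum have "s = of_real (2 * Re x)" by (simp add: complex_add_cnj)
    then have "2 < \<bar>2 * Re x\<bar>" by (rule s)
    with abs_Re_le_cmod[of x] x show False by simp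
  qed
  moreover have "cmod y < 1" if "cmod x > 1"
  proof -
    have "cmod x * cmod y = 1" using xy by (metis norm_mult norm_one)
    with that show ?thesis by (smt (verit) mult_less_cancel_right2 mult_le_cancel_left1 norm_ge_zero)
  qed
  ultimately show ?thesis using roots that by (metis linorder_neqE_linordered_idom)
qed

text \<open>These are the functions with \<open>1 / g z = z + 1 / z - c\<close>; the bound on \<open>c\<close> says that the omitted
  segment \<open>[-2 - c, 2 - c]\<close> of \<open>1 / g\<close> contains the origin. The Koebe function is the case \<open>c = 2\<close>.\<close>

lemma starlike_translated_Joukowski:
  fixes c :: real
  assumes c: "\<bar>c\<bar> \<le> 2"
  shows "(\<lambda>z. z / (1 - of_real c * z + z ^ 2)) \<in> starlike_univalent"
proof -
  define d where "d = (\<lambda>z::complex. 1 - of_real c * z + z ^ 2)"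
  define g where "g = (\<lambda>z. z / d z)"
  have d: "d z \<noteq> 0" if "cmod z < 1" for z
    unfolding d_def using that c by (rule Joukowski_omits_segment)
  have "d holomorphic_on unit_disk"
    unfolding d_def by (intro holomorphic_intros)
  then have "g holomorphic_on unit_disk"
    unfolding g_def using d by (intro holomorphic_intros) auto
  moreover have "(g has_field_derivative 1) (at 0)"
    unfolding g_def d_def by (auto intro!: derivative_eq_intros)
  ultimately have "g \<in> normalized_analytic"
    by (simp add: normalized_analytic_def analytic_on_open DERIV_imp_deriv g_def)
  moreover have "inj_on g unit_disk"
  proof (rule inj_onI)
    fix z w assume z: "z \<in> unit_disk" and w: "w \<in> unit_disk" and "g z = g w"
    then have "z * d w = w * d z"
      using d by (simp add: g_def field_simps)
    then have "z = w \<or> z * w = 1"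
      unfolding d_def by (rule quadratic_cross_eqD)
    moreover have "cmod (z * w) < 1"
      using z w by (simp add: norm_mult) (smt (verit) mult_le_one mult_left_le norm_ge_zero)
    ultimately show "z = w" by auto
  qed
  moreover have "of_real t * g z \<in> g ` unit_disk"
    if t: "t \<in> {0..1::real}" and z: "z \<in> unit_disk" for t z
  proof (cases "t = 0 \<or> z = 0")
    case True
    then have "of_real t * g z = g 0" by (auto simp: g_def)
    then show ?thesis by auto
  next
    case False
    with t have t: "0 < t" "t \<le> 1" and z0: "z \<noteq> 0" by auto
    \<comment> \<open>the value \<open>s\<close> that \<open>x + 1 / x\<close> must take in order that \<open>g x = t * g z\<close>\<close>
    define s where "s = of_real c + d z / (of_real t * z)"
    have "\<bar>r\<bar> > 2" if r: "s = of_real r" for r :: real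
    proof (rule ccontr)
      assume "\<not> \<bar>r\<bar> > 2"
      \<comment> \<open>then \<open>z + 1 / z\<close> is the convex combination \<open>(1 - t) * c + t * r\<close> of points of \<open>[-2, 2]\<close>\<close>
      then have "\<bar>(1 - t) * c\<bar> \<le> (1 - t) * 2" "\<bar>t * r\<bar> \<le> t * 2"
        using t c by (simp_all only: abs_mult) (intro mult_mono; simp)+
      then have "\<bar>(1 - t) * c + t * r\<bar> \<le> (1 - t) * 2 + t * 2"
        by linarith
      then have "1 - of_real ((1 - t) * c + t * r) * z + z ^ 2 \<noteq> 0"
        using z by (intro Joukowski_omits_segment) auto
      moreover have "d z = of_real t * (of_real r - of_real c) * z"
        using r t z0 by (simp add: s_def field_simps)
      ultimately show False by (simp add: d_def algebra_simps)
    qed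
    then obtain x where x: "cmod x < 1" "1 - s * x + x ^ 2 = 0"
      by (rule Joukowski_image)
    have "d x = d z * x / (of_real t * z)"
      using x(2) by (simp add: d_def s_def algebra_simps)
    moreover from this have "x \<noteq> 0" using d[of x] x by auto
    ultimately have "g x = of_real t * g z"
      using t z0 d[of z] d[of x] x(1) z by (simp add: g_def field_simps)
    then show ?thesis using x by (metis dist_0_norm imageI mem_ball)
  qed
  ultimately have "g \<in> starlike_univalent"
    by (auto simp: starlike_univalent_def)
  then show ?thesis by (simp add: g_def d_def)
qed

section \<open>Power series in the disk\<close>

lemma power_series_shift_sums:
  fixes z s :: complex
  assumes "(\<lambda>n. a n * z ^ n) sums s"
  shows "(\<lambda>n. case_nat 0 a n * z ^ n) sums (z * s)"
proof -
  have "(\<lambda>n. case_nat 0 a (Suc n) * z ^ Suc n) sums (z * s)"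
    using sums_mult[OF assms, of z] by (simp add: algebra_simps)
  then show ?thesis by (subst (asm) sums_Suc_iff) simp
qed

lemma cmod_power_series_minus_constant_le:
  assumes s: "(\<lambda>n. c n * z ^ n) sums s" and z: "cmod z \<le> 1"
    and c: "\<And>N. (\<Sum>k<N. cmod (c (Suc k))) \<le> M"
  shows "cmod (s - c 0) \<le> M"
proof -
  have "(\<lambda>n. c (Suc n) * z ^ Suc n) sums (s - c 0)"
    using s by (subst sums_Suc_iff) simp
  then have "(\<lambda>N. \<Sum>k<N. c (Suc k) * z ^ Suc k) \<longlonglongrightarrow> s - c 0"
    by (simp add: sums_def)
  moreover have "cmod (\<Sum>k<N. c (Suc k) * z ^ Suc k) \<le> M" for N
  proof -
    have "cmod (\<Sum>k<N. c (Suc k) * z ^ Suc k) \<le> (\<Sum>k<N. cmod (c (Suc k)))"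
      using z by (intro sum_norm_le)
        (simp add: norm_mult norm_power mult_left_le power_le_one mult_le_one del: power_Suc)
    with c[of N] show ?thesis by linarith
  qed
  ultimately show ?thesis
    by (intro Lim_norm_ubound[OF sequentially_bot]) auto
qed

lemma summable_linear_growth:
  fixes z :: complex
  assumes z: "cmod z < 1" and a: "\<And>n. cmod (a n) \<le> real n"
  shows "summable (\<lambda>n. a n * z ^ n)"
proof (rule summable_comparison_test')
  have "summable (\<lambda>n. of_nat n * cmod z ^ n :: real)"
  proof -
    \<comment> \<open>differentiating the geometric series termwise gives the coefficients \<open>n + 1\<close>\<close>
    have "summable (\<lambda>n. diffs (\<lambda>_. 1::real) n * cmod z ^ n)"
      using z by (intro termdiff_converges[where K = 1]) (auto intro: summable_geometric)
    then have "summable (\<lambda>n. cmod z * (diffs (\<lambda>_. 1::real) n * cmod z ^ n))"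
      by (rule summable_mult)
    then have "summable (\<lambda>n. real (Suc n) * cmod z ^ Suc n)"
      by (simp add: diffs_def mult_ac)
    then show ?thesis by (subst (asm) summable_Suc_iff)
  qed
  then show "summable (\<lambda>n. real n * cmod z ^ n)" .
  show "norm (a n * z ^ n) \<le> real n * cmod z ^ n" for n
    using a[of n] by (simp add: norm_mult norm_power mult_right_mono)
qed

lemma power_series_analytic_deriv_0:
  assumes f: "\<And>z. z \<in> unit_disk \<Longrightarrow> (\<lambda>n. a n * z ^ n) sums f z"
  shows "f analytic_on unit_disk" "f 0 = a 0" "deriv f 0 = a 1"
proof -
  have "f holomorphic_on unit_disk"
    using f by (intro power_series_holomorphic[where a = a]) simp
  then show "f analytic_on unit_disk" by (simp add: analytic_on_open)
  show "f 0 = a 0" using f[of 0] by (simp add: powser_sums_zero_iff)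
  have "((\<lambda>z. \<Sum>n. a n * z ^ n) has_field_derivative (\<Sum>n. diffs a n * 0 ^ n)) (at 0)"
    using f by (intro termdiffs_strong'[where K = 1]) (auto simp: sums_iff)
  then have "((\<lambda>z. \<Sum>n. a n * z ^ n) has_field_derivative a 1) (at 0)"
    by (simp add: diffs_def)
  then have "(f has_field_derivative a 1) (at 0)"
    by (rule has_field_derivative_transform_within_open[where S = unit_disk])
      (use f in \<open>auto simp: sums_iff\<close>)
  then show "deriv f 0 = a 1" by (rule DERIV_imp_deriv)
qed

lemma q_difference_sums:
  assumes q: "0 < q" "q < 1"
    and f: "\<And>z. z \<in> unit_disk \<Longrightarrow> (\<lambda>n. a n * z ^ n) sums f z"
    and z: "z \<in> unit_disk"
  shows "(\<lambda>n. a (Suc n) * of_real ((1 - q ^ Suc n) / (1 - q)) * z ^ n) sums q_difference q f z"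
proof (cases "z = 0")
  case True
  have "(\<lambda>n. a (Suc n) * of_real ((1 - q ^ Suc n) / (1 - q)) * 0 ^ n) sums a 1"
    using powser_sums_zero[of "\<lambda>n. a (Suc n) * of_real ((1 - q ^ Suc n) / (1 - q))"] q by simp
  then show ?thesis
    using True power_series_analytic_deriv_0(3)[OF f] by (simp add: q_difference_def)
next
  case False
  have "cmod (of_real q * z) < 1"
    using q z by (simp add: norm_mult) (smt (verit) mult_left_le norm_ge_zero mult_le_one mult_less_cancel_right2)
  then have "(\<lambda>n. a n * z ^ n - a n * (of_real q * z) ^ n) sums (f z - f (of_real q * z))"
    using z by (intro sums_diff f) auto
  then have "(\<lambda>n. a (Suc n) * z ^ Suc n - a (Suc n) * (of_real q * z) ^ Suc n)
      sums (f z - f (of_real q * z))"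
    by (subst sums_Suc_iff) simp
  from sums_divide[OF this, of "z * of_real (1 - q)"]
  have "(\<lambda>n. (a (Suc n) * z ^ Suc n - a (Suc n) * (of_real q * z) ^ Suc n) / (z * of_real (1 - q)))
      sums q_difference q f z"
    using False by (simp add: q_difference_def)
  moreover have "(a (Suc n) * z ^ Suc n - a (Suc n) * (of_real q * z) ^ Suc n) / (z * of_real (1 - q))
      = a (Suc n) * of_real ((1 - q ^ Suc n) / (1 - q)) * z ^ n" for n
  proof -
    have "a (Suc n) * z ^ Suc n - a (Suc n) * (of_real q * z) ^ Suc n
        = z * (a (Suc n) * of_real (1 - q ^ Suc n) * z ^ n)"
      by (simp add: power_mult_distrib algebra_simps)
    then show ?thesis using False by simp
  qed
  ultimately show ?thesis by (simp only:)
qed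

section \<open>Multiplication of the coefficients by \<open>1 - z + z\<^sup>2\<close>\<close>

definition trinomial_coeff :: "(nat \<Rightarrow> 'a::ring_1) \<Rightarrow> nat \<Rightarrow> 'a"
  where "trinomial_coeff b n = b n - case_nat 0 b n + case_nat 0 (case_nat 0 b) n"

lemma trinomial_coeff_simps:
  "trinomial_coeff b 0 = b 0"
  "trinomial_coeff b (Suc 0) = b 1 - b 0"
  "trinomial_coeff b (Suc (Suc n)) = b (Suc (Suc n)) - b (Suc n) + b n"
  by (simp_all add: trinomial_coeff_def)

lemma trinomial_coeff_of_real:
  "trinomial_coeff (\<lambda>n. of_real (b n)) n = of_real (trinomial_coeff b n)"
  by (simp add: trinomial_coeff_def split: nat.split)

lemma trinomial_coeff_sums:
  fixes z s :: complex
  assumes "(\<lambda>n. b n * z ^ n) sums s"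
  shows "(\<lambda>n. trinomial_coeff b n * z ^ n) sums ((1 - z + z ^ 2) * s)"
proof -
  note 1 = power_series_shift_sums[OF assms]
  note 2 = power_series_shift_sums[OF 1]
  from sums_add[OF sums_diff[OF assms 1] 2] show ?thesis
    by (simp add: trinomial_coeff_def algebra_simps power2_eq_square)
qed

text \<open>Because \<open>(1 + z) * (1 - z + z\<^sup>2) = 1 + z ^ 3\<close>, adding two consecutive coefficients of the product
  gives \<open>b\<^sub>n\<^sub>+\<^sub>3 + b\<^sub>n\<close>: three steps raise \<open>\<bar>b\<bar>\<close> by at most \<open>2\<close>.\<close>

lemma coeff_growth:
  fixes b :: "nat \<Rightarrow> real"
  assumes c: "\<And>n. \<bar>trinomial_coeff b n\<bar> \<le> 1"
  shows "\<bar>b n\<bar> \<le> real (Suc n)"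
proof (induction n rule: less_induct)
  case (less n)
  consider "n = 0" | "n = 1" | "n = 2" | m where "n = m + 3"
    by (metis One_nat_def Suc_1 add.commute add_Suc_right numeral_3_eq_3 old.nat.exhaust add_0)
  then show ?case
  proof cases
    case 4
    have "b (m + 3) = trinomial_coeff b (m + 3) + trinomial_coeff b (m + 2) - b m"
      by (simp add: trinomial_coeff_simps numeral_eq_Suc)
    moreover have "\<bar>b m\<bar> \<le> real (Suc m)" using less.IH[of m] 4 by simp
    ultimately show ?thesis using c[of "m + 3"] c[of "m + 2"] 4 by simp
  qed (use c[of 0] c[of 1] c[of 2] in \<open>simp_all add: trinomial_coeff_simps numeral_2_eq_2\<close>)
qed

text \<open>Each \<open>B k\<close> enters three consecutive coefficients, with signs \<open>+\<close>, \<open>-\<close>, \<open>+\<close>, and so survives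
  once. The exceptions are at the ends: \<open>B 1\<close> loses its first \<open>+\<close> to \<open>c 0\<close> and cancels, and of the last
  two, \<open>B (m + 2)\<close> cancels as well because its second \<open>+\<close> has not been reached. This gap is the one in the
  terms of the chain.\<close>

lemma trinomial_coeff_partial_sums:
  fixes B :: "nat \<Rightarrow> 'a::ring_1"
  defines "c \<equiv> trinomial_coeff (\<lambda>n. B (Suc n))"
  shows "(\<Sum>k<Suc (Suc m). c (Suc k)) = (\<Sum>k=2..<m + 2. B k) + B (m + 3)"
proof (induction m)
  case 0
  then show ?case by (simp add: c_def trinomial_coeff_simps numeral_eq_Suc)
next
  case (Suc m)
  have "c (Suc (Suc (Suc m))) = B (m + 4) - B (m + 3) + B (m + 2)"
    by (simp add: c_def trinomial_coeff_simps numeral_eq_Suc)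
  moreover have "(\<Sum>k=2..<Suc m + 2. B k) = (\<Sum>k=2..<m + 2. B k) + B (m + 2)"
    by simp
  ultimately show ?case
    using Suc.IH by (subst sum.lessThan_Suc) (simp add: algebra_simps)
qed

text \<open>Partial sums that move monotonically away from \<open>0\<close> add up terms of one sign, so that bounding
  them bounds the sums of absolute values. The sign \<open>\<sigma>\<close> covers both directions.\<close>

lemma sum_abs_le_of_monotone_partial_sums:
  fixes c :: "nat \<Rightarrow> real"
  assumes sign: "\<bar>\<sigma>\<bar> = 1" and nonneg: "\<And>k. 0 \<le> \<sigma> * c k"
    and bound: "\<And>N. \<sigma> * (\<Sum>k<N + 2. c k) \<le> M"
  shows "(\<Sum>k<N. \<bar>c k\<bar>) \<le> M"
proof -
  have abs: "\<bar>c k\<bar> = \<sigma> * c k" for k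
    using nonneg[of k] sign by (metis abs_mult abs_of_nonneg mult_1)
  have "(\<Sum>k<N. \<bar>c k\<bar>) \<le> (\<Sum>k<N + 2. \<bar>c k\<bar>)"
    by (intro sum_mono2) auto
  also have "\<dots> = \<sigma> * (\<Sum>k<N + 2. c k)"
    by (simp only: abs sum_distrib_left)
  finally show ?thesis using bound[of N] by linarith
qed

section \<open>The criterion\<close>

lemma chain_imp_sum_abs_le:
  fixes B :: "nat \<Rightarrow> real"
  assumes chain:
      "(0 \<ge> B 2 - B 1 \<and> B 2 - B 1 \<ge> B 3 \<and>
        (\<forall>n\<ge>2. (\<Sum>k=2..<n. B k) + B (n + 1) \<ge> (\<Sum>k=2..<n+1. B k) + B (n + 2)) \<and>
        (\<forall>n\<ge>2. (\<Sum>k=2..<n. B k) + B (n + 1) \<ge> -1))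
       \<or>
       (0 \<le> B 2 - B 1 \<and> B 2 - B 1 \<le> B 3 \<and>
        (\<forall>n\<ge>2. (\<Sum>k=2..<n. B k) + B (n + 1) \<le> (\<Sum>k=2..<n+1. B k) + B (n + 2)) \<and>
        (\<forall>n\<ge>2. (\<Sum>k=2..<n. B k) + B (n + 1) \<le> 1))"
  shows "(\<Sum>k<N. \<bar>trinomial_coeff (\<lambda>n. B (Suc n)) (Suc k)\<bar>) \<le> 1"
proof -
  define c where "c = (\<lambda>k. trinomial_coeff (\<lambda>n. B (Suc n)) (Suc k))"
  define S where "S = (\<lambda>n. (\<Sum>k=2..<n. B k) + B (n + 1))"
  have c0: "c 0 = B 2 - B 1" and S2: "S 2 = B 3"
    by (simp_all add: c_def S_def trinomial_coeff_simps numeral_eq_Suc)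
  have S: "(\<Sum>k<m + 2. c k) = S (m + 2)" for m
    using trinomial_coeff_partial_sums[of B m] by (simp add: c_def S_def numeral_3_eq_3)
  have c1: "c 1 = S 2 - (B 2 - B 1)"
    using S[of 0] c0 by (simp add: numeral_2_eq_2)
  have cm: "c (m + 2) = S (m + 3) - S (m + 2)" for m
    using S[of m] S[of "Suc m"] by (simp add: numeral_3_eq_3)
  obtain \<sigma> :: real where \<sigma>: "\<bar>\<sigma>\<bar> = 1" and first: "0 \<le> \<sigma> * (B 2 - B 1)"
    and second: "\<sigma> * (B 2 - B 1) \<le> \<sigma> * S 2"
    and mono: "\<And>n. n \<ge> 2 \<Longrightarrow> \<sigma> * S n \<le> \<sigma> * S (n + 1)"
    and bound: "\<And>n. n \<ge> 2 \<Longrightarrow> \<sigma> * S n \<le> 1"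
    using chain
  proof
    assume "0 \<ge> B 2 - B 1 \<and> B 2 - B 1 \<ge> B 3 \<and>
        (\<forall>n\<ge>2. (\<Sum>k=2..<n. B k) + B (n + 1) \<ge> (\<Sum>k=2..<n+1. B k) + B (n + 2)) \<and>
        (\<forall>n\<ge>2. (\<Sum>k=2..<n. B k) + B (n + 1) \<ge> -1)"
    then have "0 \<ge> B 2 - B 1" "B 2 - B 1 \<ge> S 2" "\<And>n. n \<ge> 2 \<Longrightarrow> S n \<ge> S (n + 1)"
      "\<And>n. n \<ge> 2 \<Longrightarrow> S n \<ge> -1"
      unfolding S2 by (simp_all add: S_def)
    then show thesis by (intro that[of "- 1"]) (simp_all add: minus_le_iff)
  next
    assume "0 \<le> B 2 - B 1 \<and> B 2 - B 1 \<le> B 3 \<and>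
        (\<forall>n\<ge>2. (\<Sum>k=2..<n. B k) + B (n + 1) \<le> (\<Sum>k=2..<n+1. B k) + B (n + 2)) \<and>
        (\<forall>n\<ge>2. (\<Sum>k=2..<n. B k) + B (n + 1) \<le> 1)"
    then have "0 \<le> B 2 - B 1" "B 2 - B 1 \<le> S 2" "\<And>n. n \<ge> 2 \<Longrightarrow> S n \<le> S (n + 1)"
      "\<And>n. n \<ge> 2 \<Longrightarrow> S n \<le> 1"
      unfolding S2 by (simp_all add: S_def)
    then show thesis by (intro that[of 1]) simp_all
  qed
  have "0 \<le> \<sigma> * c k" for k
  proof -
    consider "k = 0" | "k = 1" | m where "k = m + 2"
      by (metis One_nat_def add_2_eq_Suc' old.nat.exhaust)
    then show ?thesis
    proof cases
      case 1
      with first c0 show ?thesis by simp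
    next
      case 2
      with second c1 show ?thesis by (simp add: right_diff_distrib)
    next
      case 3
      with mono[of "m + 2"] cm[of m] show ?thesis
        by (simp add: right_diff_distrib numeral_eq_Suc)
    qed
  qed
  moreover have "\<sigma> * (\<Sum>k<N + 2. c k) \<le> 1" for N
    unfolding S by (rule bound) simp
  ultimately have "(\<Sum>k<N. \<bar>c k\<bar>) \<le> 1"
    by (rule sum_abs_le_of_monotone_partial_sums[OF \<sigma>])
  then show ?thesis by (simp add: c_def)
qed

theorem theorem2p11:
  fixes q :: real and A B :: "nat \<Rightarrow> real" and f g :: "complex \<Rightarrow> complex"
  assumes q: "0 < q" "q < 1"
    and A1: "A 1 = 1"
    and B: "\<And>n. n \<ge> 1 \<Longrightarrow> B n = A n * (1 - q ^ n) / (1 - q)"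
    and chain:
      "(0 \<ge> B 2 - B 1 \<and> B 2 - B 1 \<ge> B 3 \<and>
        (\<forall>n\<ge>2. (\<Sum>k=2..<n. B k) + B (n + 1) \<ge> (\<Sum>k=2..<n+1. B k) + B (n + 2)) \<and>
        (\<forall>n\<ge>2. (\<Sum>k=2..<n. B k) + B (n + 1) \<ge> -1))
       \<or>
       (0 \<le> B 2 - B 1 \<and> B 2 - B 1 \<le> B 3 \<and>
        (\<forall>n\<ge>2. (\<Sum>k=2..<n. B k) + B (n + 1) \<le> (\<Sum>k=2..<n+1. B k) + B (n + 2)) \<and>
        (\<forall>n\<ge>2. (\<Sum>k=2..<n. B k) + B (n + 1) \<le> 1))"
    and f: "\<And>z. f z = z + (\<Sum>n. of_real (A (n + 2)) * z ^ (n + 2))"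
    and g: "\<And>z. g z = z / (1 - z + z ^ 2)"
  shows "(\<forall>z\<in>unit_disk. summable (\<lambda>n. of_real (A (n + 2)) * z ^ (n + 2))) \<and>
    f \<in> q_close_to_convex q \<and> q_close_to_convex_with q f g"
proof -
  define c where "c = trinomial_coeff (\<lambda>n. B (Suc n))"
  have B1: "B 1 = 1" using B[of 1] A1 q by simp
  have c0: "c 0 = 1" using B1 by (simp add: c_def trinomial_coeff_simps)
  have sum_c: "(\<Sum>k<N. \<bar>c (Suc k)\<bar>) \<le> 1" for N
    unfolding c_def using chain by (rule chain_imp_sum_abs_le)
  have "\<bar>c n\<bar> \<le> 1" for n
  proof (cases n)
    case (Suc k)
    have "\<bar>c (Suc k)\<bar> \<le> (\<Sum>j<Suc k. \<bar>c (Suc j)\<bar>)"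
      by (rule member_le_sum) auto
    also have "\<dots> \<le> 1" by (rule sum_c)
    finally show ?thesis using Suc by simp
  qed (simp add: c0)
  then have B_growth: "\<bar>B (Suc n)\<bar> \<le> real (Suc n)" for n
    unfolding c_def by (rule coeff_growth)
  have A_growth: "\<bar>A (Suc n)\<bar> \<le> real (Suc n)" for n
  proof -
    have "q ^ Suc n \<le> q" using q by (simp add: mult_left_le power_le_one)
    then have "1 \<le> (1 - q ^ Suc n) / (1 - q)" using q by simp
    then have "\<bar>A (Suc n)\<bar> * 1 \<le> \<bar>A (Suc n)\<bar> * \<bar>(1 - q ^ Suc n) / (1 - q)\<bar>"
      by (intro mult_left_mono) linarith+
    also have "\<dots> = \<bar>B (Suc n)\<bar>"
      using B[of "Suc n"] by (simp add: abs_mult)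
    finally show ?thesis using B_growth[of n] by simp
  qed
  \<comment> \<open>\<open>A 0\<close> is arbitrary, while \<open>f\<close> has no constant term\<close>
  define a :: "nat \<Rightarrow> complex" where "a = case_nat 0 (\<lambda>n. of_real (A (Suc n)))"
  have "cmod (a n) \<le> real n" for n
    using A_growth by (simp add: a_def split: nat.split del: of_nat_Suc)
  then have summable_a: "summable (\<lambda>n. a n * z ^ n)" if "z \<in> unit_disk" for z
    using that by (intro summable_linear_growth) simp_all
  have summable: "summable (\<lambda>n. of_real (A (n + 2)) * z ^ (n + 2))" if "z \<in> unit_disk" for z :: complex
    using summable_ignore_initial_segment[OF summable_a[OF that], of 2] by (simp add: a_def)
  have f_sums: "(\<lambda>n. a n * z ^ n) sums f z" if "z \<in> unit_disk" for z
  proof -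
    have "(\<lambda>n. a (n + 2) * z ^ (n + 2)) sums (f z - z)"
      using summable_sums[OF summable[OF that]] by (simp add: f a_def)
    then show ?thesis
      by (subst (asm) sums_iff_shift) (use A1 in \<open>simp add: a_def numeral_2_eq_2\<close>)
  qed
  have f_norm: "f \<in> normalized_analytic"
    using power_series_analytic_deriv_0[OF f_sums] A1
    by (simp add: normalized_analytic_def a_def)
  have "g = (\<lambda>z. z / (1 - of_real 1 * z + z ^ 2))"
    by (simp add: fun_eq_iff g)
  then have g_starlike: "g \<in> starlike_univalent"
    using starlike_translated_Joukowski[of 1] by simp
  have "cmod ((if z = 0 then 1 else z / g z) * q_difference q f z - of_real (1 / (1 - q))) \<le> 1 / (1 - q)"
    if z: "z \<in> unit_disk" for z
  proof -
    define w where "w = (1 - z + z ^ 2) * q_difference q f z"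
    have "(\<lambda>n. of_real (B (Suc n)) * z ^ n) sums q_difference q f z"
      using q_difference_sums[OF q f_sums z] B by (simp add: a_def mult_ac)
    from trinomial_coeff_sums[OF this] have "(\<lambda>n. of_real (c n) * z ^ n) sums w"
      by (simp add: trinomial_coeff_of_real c_def w_def)
    then have "cmod (w - of_real (c 0)) \<le> 1"
      by (rule cmod_power_series_minus_constant_le) (use z sum_c in simp_all)
    then have "cmod (w - 1) \<le> 1" by (simp add: c0)
    moreover have "cmod (1 - of_real (1 / (1 - q))) = 1 / (1 - q) - 1"
    proof -
      have "1 - of_real (1 / (1 - q)) = (of_real (1 - 1 / (1 - q)) :: complex)" by simp
      moreover have "1 \<le> 1 / (1 - q)" using q by simp
      ultimately show ?thesis by (simp only: norm_of_real)
    qed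
    moreover have "w - of_real (1 / (1 - q)) = (w - 1) + (1 - of_real (1 / (1 - q)))"
      by simp
    ultimately have "cmod (w - of_real (1 / (1 - q))) \<le> 1 / (1 - q)"
      using norm_triangle_ineq[of "w - 1" "1 - of_real (1 / (1 - q))"] by (simp only:)
    moreover have "(if z = 0 then 1 else z / g z) = 1 - z + z ^ 2"
      by (simp add: g)
    ultimately show ?thesis by (simp only: w_def)
  qed
  with f_norm g_starlike have "q_close_to_convex_with q f g"
    by (simp add: q_close_to_convex_with_def)
  then show ?thesis
    using summable by (auto simp: q_close_to_convex_def)
qed

end
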